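(* Let $A:\mathbb{F}^d\to\mathbb{F}^d$ be a linear operator with $1\notin\sigma(A)$, and let $W$ be a $K$-dimensional subspace of $\mathbb{F}^d$. If the set $\{b_1,\dots,b_L\}\subset\mathbb{F}^d$ forms a complete observational set for the source recovery problem (for $A$ and $W$), then $L\ge K$.
   Context: $\mathbb{F}$ is $\mathbb{R}$ or $\mathbb{C}$, $\langle x,y\rangle=y^*x$ is the canonical inner product on $\mathbb{F}^d$, and $\sigma(A)$ is the spectrum of $A$. Source recovery problem: given $A$ with adjoint $A^*$, a subspace $W\subseteq\mathbb{F}^d$ and vectors $b_1,\dots,b_L\in\mathbb{F}^d$ (called spatial observational vectors), consider the dynamics $x(n+1)=A^*x(n)+\omega$, $n\in\mathbb{N}_0$, $x(0)=x_0$, where the constant source $\omega\in W$ and the initial state $x_0\in\mathbb{F}^d$ are unknown, with measurements $y_\ell(n)=\langle x(n),b_\ell\rangle$, $1\le\ell\le L$. The set $\{b_1,\dots,b_L\}$ is complete if every $\omega\in W$ can be recovered, regardless of $x_0$, by finitely many linear operations from finitely many measurements; that is, there exist $T\in\mathbb{N}_0$ and vectors $u_{n,\ell}\in\mathbb{F}^d$ ($0\le n\le T$, $1\le\ell\le L$) such that $\omega=\sum_{n,\ell}y_\ell(n)\,u_{n,\ell}$ for all $x_0\in\mathbb{F}^d$ and all $\omega\in W$. *)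

theory Defs
  imports "HOL-Analysis.Analysis" "Jordan_Normal_Form.Conjugate"
begin

text \<open>
  The definitions are generic in the scalar field so that they serve both the real and the complex
  scalars; \<open>conjugate\<close> is the identity on \<open>real\<close> and \<open>cnj\<close> on \<open>complex\<close>.
\<close>

definition hinner :: "'a::conjugatable_field ^ 'd \<Rightarrow> 'a ^ 'd \<Rightarrow> 'a" where
  "hinner x y = (\<Sum>i\<in>UNIV. conjugate (y $ i) * x $ i)"

text \<open>
  The library's \<open>adjoint\<close> is tied to the real inner product; this is its definition with \<open>hinner\<close>
  in place of \<open>inner\<close>.
\<close>

definition hadjoint ::
    "('a::conjugatable_field ^ 'd \<Rightarrow> 'a ^ 'd) \<Rightarrow> 'a ^ 'd \<Rightarrow> 'a ^ 'd" where
  "hadjoint A = (SOME A'. \<forall>x y. hinner (A x) y = hinner x (A' y))"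

text \<open>In finite dimension the inverse of a bijective linear operator is automatically
  linear, so invertibility is bijectivity.\<close>

definition op_spectrum :: "('a::field ^ 'd \<Rightarrow> 'a ^ 'd) \<Rightarrow> 'a set" where
  "op_spectrum A = {c. \<not> bij (\<lambda>x. A x - c *s x)}"

primrec source_state ::
    "('a::conjugatable_field ^ 'd \<Rightarrow> 'a ^ 'd) \<Rightarrow> 'a ^ 'd \<Rightarrow> 'a ^ 'd \<Rightarrow> nat \<Rightarrow> 'a ^ 'd" where
  "source_state A \<omega> x0 0 = x0"
| "source_state A \<omega> x0 (Suc n) = hadjoint A (source_state A \<omega> x0 n) + \<omega>"

definition complete_observational ::
    "('a::conjugatable_field ^ 'd \<Rightarrow> 'a ^ 'd) \<Rightarrow> ('a ^ 'd) set \<Rightarrow> nat \<Rightarrow> (nat \<Rightarrow> 'a ^ 'd) \<Rightarrow> bool" where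
  "complete_observational A W L b \<longleftrightarrow>
     (\<exists>T. \<exists>u :: nat \<Rightarrow> nat \<Rightarrow> 'a ^ 'd. \<forall>x0. \<forall>\<omega>\<in>W.
        \<omega> = (\<Sum>n\<in>{0..T}. \<Sum>l\<in>{1..L}. hinner (source_state A \<omega> x0 n) (b l) *s u n l))"

lemma hinner_real: "hinner x y = inner x (y :: real ^ 'd)"
  by (simp add: hinner_def inner_vec_def mult.commute)

lemma hadjoint_real: "hadjoint A = adjoint (A :: real ^ 'd \<Rightarrow> real ^ 'd)"
  by (simp add: hadjoint_def adjoint_def hinner_real)

lemma hinner_matrix_vector:
  fixes M :: "'a::conjugatable_field ^ 'd ^ 'd"
  shows "hinner (M *v x) y = hinner x ((\<chi> i j. conjugate (M $ j $ i)) *v y)"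
proof -
  have "hinner (M *v x) y = (\<Sum>i\<in>UNIV. \<Sum>j\<in>UNIV. conjugate (y $ i) * (M $ i $ j * x $ j))"
    by (simp add: hinner_def matrix_vector_mult_def sum_distrib_left)
  also have "\<dots> = (\<Sum>j\<in>UNIV. \<Sum>i\<in>UNIV. conjugate (y $ i) * (M $ i $ j * x $ j))"
    by (rule sum.swap)
  also have "\<dots> = hinner x ((\<chi> i j. conjugate (M $ j $ i)) *v y)"
    unfolding hinner_def matrix_vector_mult_def
    by (auto simp: sum_conjugate conjugate_dist_mul sum_distrib_right intro!: sum.cong)
  finally show ?thesis .
qed

lemma hadjoint_works:
  fixes A :: "'a::conjugatable_field ^ 'd \<Rightarrow> 'a ^ 'd"
  assumes "Vector_Spaces.linear (*s) (*s) A"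
  shows "hinner (A x) y = hinner x (hadjoint A y)"
proof -
  have "hinner (A x) y = hinner x ((\<chi> i j. conjugate (matrix A $ j $ i)) *v y)" for x y
    using hinner_matrix_vector[of "matrix A" x y] by (simp only: matrix_works[OF assms])
  then have "\<exists>A'. \<forall>x y. hinner (A x) y = hinner x (A' y)"
    by (intro exI[of _ "\<lambda>y. (\<chi> i j. conjugate (matrix A $ j $ i)) *v y"]) blast
  from someI_ex[OF this] show ?thesis
    unfolding hadjoint_def by blast
qed

end

theory Submission
  imports Defs
begin

text \<open>
  Since \<open>1\<close> is not an eigenvalue of \<open>A\<^sup>*\<close>, every \<open>\<omega>\<close> is the source of a stationary orbit, started at
  the solution of \<open>x = A\<^sup>* x + \<omega>\<close>. The measurements of this orbit do not depend on time, so \<open>\<omega> \<in> W\<close> is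
  a linear combination of the \<open>L\<close> vectors \<open>\<Sum>n\<le>T. u n l\<close>.
\<close>

lemma hinner_axis: "hinner (axis i 1) y = conjugate (y $ i)"
  by (simp add: hinner_def axis_def if_distrib cong: if_cong)

text \<open>Testing against \<open>axis i 1\<close> reads off the conjugated i-th coordinate, and
  conjugation is injective.\<close>

lemma hinner_eqI:
  assumes "\<And>x. hinner x y = hinner x z"
  shows "y = z"
proof (rule vec_eq_iff[THEN iffD2], rule allI)
  fix i
  show "y $ i = z $ i"
    using assms[of "axis i 1"] by (simp add: hinner_axis)
qed

lemma hinner_diff_left: "hinner (x - y) z = hinner x z - hinner y z"
  by (simp add: hinner_def right_diff_distrib sum_subtractf)

text \<open>Nondegeneracy of \<open>hinner\<close> leaves only one candidate for the
  \<open>SOME\<close> in \<open>hadjoint\<close>. The conjugate transpose makes its linearity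
  visible.\<close>

lemma hadjoint_matrix:
  fixes A :: "'a::conjugatable_field ^ 'd \<Rightarrow> 'a ^ 'd"
  assumes "Vector_Spaces.linear (*s) (*s) A"
  shows "hadjoint A = (*v) (\<chi> i j. conjugate (matrix A $ j $ i))"
proof (rule ext, rule hinner_eqI)
  fix x y
  show "hinner x (hadjoint A y) = hinner x ((\<chi> i j. conjugate (matrix A $ j $ i)) *v y)"
    using hinner_matrix_vector[of "matrix A" x y] hadjoint_works[OF assms, of x y]
    by (simp only: matrix_works[OF assms])
qed

lemma linear_hadjoint:
  assumes "Vector_Spaces.linear (*s) (*s) A"
  shows "Vector_Spaces.linear (*s) (*s) (hadjoint A)"
  unfolding hadjoint_matrix[OF assms] by (rule matrix_vector_mul_linear_gen)

text \<open>A fixed vector of \<open>hadjoint A\<close> is orthogonal to the range of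
  \<open>A - I\<close>, which is the whole space because 1 is not in the spectrum. So
  \<open>I - hadjoint A\<close> is injective, hence surjective in finite dimension.\<close>

lemma stationary_state_exists:
  fixes A :: "'a::conjugatable_field ^ 'd \<Rightarrow> 'a ^ 'd"
  assumes lin: "Vector_Spaces.linear (*s) (*s) A" and spec: "1 \<notin> op_spectrum A"
  obtains x where "x = hadjoint A x + \<omega>"
proof -
  interpret adj: Vector_Spaces.linear "(*s)" "(*s)" "hadjoint A"
    by (rule linear_hadjoint[OF lin])
  let ?B = "\<lambda>x. x - hadjoint A x"
  have linB: "Vector_Spaces.linear (*s) (*s) ?B"
    by (intro vec.linear_compose_sub vec.linear_ident adj.linear_axioms)
  have surj: "surj (\<lambda>x. A x - x)"
    using spec by (simp add: op_spectrum_def bij_def)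
  have "y = 0" if "?B y = 0" for y
  proof (rule hinner_eqI)
    fix z
    obtain x where z: "z = A x - x"
      using surj by (rule surjE)
    have "hinner z y = hinner x (hadjoint A y) - hinner x y"
      by (simp add: z hinner_diff_left hadjoint_works[OF lin])
    then show "hinner z y = hinner z 0"
      using that by (simp add: hinner_def)
  qed
  then have "inj ?B"
    by (simp add: vec.linear_inj_iff_eq_0[OF linB])
  then have "surj ?B"
    by (rule vec.linear_inj_imp_surj[OF linB])
  then obtain x where "\<omega> = ?B x"
    by (rule surjE)
  then show thesis
    by (intro that[of x]) simp
qed

lemma source_state_stationary:
  assumes "x = hadjoint A x + \<omega>"
  shows "source_state A \<omega> x n = x"
  \<comment> \<open>Oriented this way, the equation folds the right-hand side back to
    \<open>x\<close>; the other direction would loop.\<close>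
  by (induction n) (simp_all add: assms[symmetric])

text \<open>Keeping the scalar field generic lets one argument serve both the real and the complex
  case.\<close>

lemma complete_observational_dim_le:
  fixes A :: "'a::conjugatable_field ^ 'd \<Rightarrow> 'a ^ 'd"
  assumes lin: "Vector_Spaces.linear (*s) (*s) A" and spec: "1 \<notin> op_spectrum A"
    and "complete_observational A W L b"
  shows "vec.dim W \<le> L"
proof -
  obtain T u where rec: "\<And>x0 \<omega>. \<omega> \<in> W \<Longrightarrow>
      \<omega> = (\<Sum>n\<in>{0..T}. \<Sum>l\<in>{1..L}. hinner (source_state A \<omega> x0 n) (b l) *s u n l)"
    using assms(3) unfolding complete_observational_def by blast
  define v where "v l = (\<Sum>n\<in>{0..T}. u n l)" for l
  have "W \<subseteq> vec.span (v ` {1..L})"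
  proof
    fix \<omega> assume "\<omega> \<in> W"
    obtain x where x: "x = hadjoint A x + \<omega>"
      using stationary_state_exists[OF lin spec] .
    \<comment> \<open>Recovery holds for every initial state, so the state may be chosen depending
      on \<open>\<omega>\<close>.\<close>
    have "\<omega> = (\<Sum>n\<in>{0..T}. \<Sum>l\<in>{1..L}. hinner x (b l) *s u n l)"
      using rec[OF \<open>\<omega> \<in> W\<close>, of x] unfolding source_state_stationary[OF x] .
    also have "\<dots> = (\<Sum>l\<in>{1..L}. hinner x (b l) *s v l)"
      unfolding v_def vec.scale_sum_right by (rule sum.swap)
    also have "\<dots> \<in> vec.span (v ` {1..L})"
      by (intro vec.span_sum vec.span_scale vec.span_base imageI)
    finally show "\<omega> \<in> vec.span (v ` {1..L})" .
  qed
  then have "vec.dim W \<le> card (v ` {1..L})"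
    by (rule vec.dim_le_card) simp
  \<comment> \<open>Only an inequality, since the vectors \<open>v l\<close> may coincide.\<close>
  also have "\<dots> \<le> L"
    using card_image_le[of "{1..L}" v] by simp
  finally show ?thesis .
qed

theorem corollary2p6:
  shows
    "(\<forall>(A :: real ^ 'd \<Rightarrow> real ^ 'd) (W :: (real ^ 'd) set) (b :: nat \<Rightarrow> real ^ 'd) (K :: nat) (L :: nat).
        Vector_Spaces.linear (*s) (*s) A \<longrightarrow> 1 \<notin> op_spectrum A \<longrightarrow>
        vec.subspace W \<longrightarrow> vec.dim W = K \<longrightarrow>
        complete_observational A W L b \<longrightarrow> L \<ge> K)
     \<and>
     (\<forall>(A :: complex ^ 'd \<Rightarrow> complex ^ 'd) (W :: (complex ^ 'd) set) (b :: nat \<Rightarrow> complex ^ 'd) (K :: nat) (L :: nat).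
        Vector_Spaces.linear (*s) (*s) A \<longrightarrow> 1 \<notin> op_spectrum A \<longrightarrow>
        vec.subspace W \<longrightarrow> vec.dim W = K \<longrightarrow>
        complete_observational A W L b \<longrightarrow> L \<ge> K)"
  by (auto intro!: complete_observational_dim_le)

end
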